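(* Let $f:\mathbb{N}\times\mathbb{N}\to\mathbb{R}_{\ge 0}$ satisfy $f(n,m)=o(|E(P_n\square P_m)|)$ as $n,m\to\infty$. There is a polynomial-time algorithm for grid STAR such that for every $\varepsilon>0$ there exist positive numbers $n_\varepsilon,m_\varepsilon$ such that, for every instance $(G,X)$ where $G=(V,E)$ is a grid graph with $n\ge n_\varepsilon$ rows, $m\ge m_\varepsilon$ columns, and $|E\setminus X|\le f(n,m)$, the algorithm outputs a cycle covering $X$ of length at most $(3/2+\varepsilon)\,\mathrm{OPT}$.
   Context: STAR: given a simple graph $G=(V,E)$ and non-empty $X\subseteq E$, find a minimum-length cycle, not necessarily simple (a closed walk, possibly a single vertex of length $0$; length counts edges with repetitions), covering $X$, i.e. every edge of $X$ has an endpoint among the cycle's vertices; $\mathrm{OPT}$ denotes this minimum length. Grid STAR is STAR restricted to $G$ a grid graph; a grid graph with $n$ rows and $m$ columns is $P_n\square P_m$. The paper phrases the density hypothesis as $|E\setminus X|=o(|E|)$; here it is made precise via the bound $f$. *)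

theory Defs
  imports
    Complex_Main
    "HOL-Library.Landau_Symbols"
    "HOL-Computational_Algebra.Polynomial"
begin

section \<open>Graphs, walks and STAR\<close>

text \<open>A simple graph is a vertex set together with a set of two-element subsets of it.\<close>

type_synonym 'a graph = "'a set \<times> 'a set set"

abbreviation verts :: "'a graph \<Rightarrow> 'a set" where "verts G \<equiv> fst G"
abbreviation edges :: "'a graph \<Rightarrow> 'a set set" where "edges G \<equiv> snd G"

definition path_graph :: "nat \<Rightarrow> nat graph" where
  "path_graph n = ({..<n}, {{i, Suc i} | i. Suc i < n})"

definition box_product :: "'a graph \<Rightarrow> 'b graph \<Rightarrow> ('a \<times> 'b) graph" (infixl "\<box>" 70) where
  "G \<box> H =
    (verts G \<times> verts H,
     {{(u, x), (v, x)} | u v x. {u, v} \<in> edges G \<and> x \<in> verts H} \<union>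
     {{(u, x), (u, y)} | u x y. u \<in> verts G \<and> {x, y} \<in> edges H})"

definition grid :: "nat \<Rightarrow> nat \<Rightarrow> (nat \<times> nat) graph" where
  "grid n m = path_graph n \<box> path_graph m"

text \<open>A cycle, not necessarily simple, is the list \<open>[v\<^sub>0, \<dots>, v\<^sub>k]\<close> of the vertices of a closed
  walk, with \<open>v\<^sub>0 = v\<^sub>k\<close> written twice; its length is \<open>k\<close>, and \<open>[v]\<close> has length \<open>0\<close>.\<close>

definition closed_walk :: "'a graph \<Rightarrow> 'a list \<Rightarrow> bool" where
  "closed_walk G p \<longleftrightarrow>
    p \<noteq> [] \<and> set p \<subseteq> verts G \<and>
    (\<forall>i. Suc i < length p \<longrightarrow> {p ! i, p ! Suc i} \<in> edges G) \<and> hd p = last p"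

definition walk_length :: "'a list \<Rightarrow> nat" where
  "walk_length p = length p - 1"

definition covers :: "'a list \<Rightarrow> 'a set set \<Rightarrow> bool" where
  "covers p X \<longleftrightarrow> (\<forall>e\<in>X. \<exists>v\<in>set p. v \<in> e)"

definition OPT :: "'a graph \<Rightarrow> 'a set set \<Rightarrow> nat" where
  "OPT G X = (LEAST k. \<exists>p. closed_walk G p \<and> covers p X \<and> walk_length p = k)"

definition star_instance :: "'a graph \<Rightarrow> 'a set set \<Rightarrow> bool" where
  "star_instance G X \<longleftrightarrow> X \<noteq> {} \<and> X \<subseteq> edges G"


section \<open>Random access machines and polynomial time\<close>

text \<open>
  Structured programs for a random access machine with registers and an unbounded memory, all
  cells holding natural numbers. Subtraction is truncated. Every instruction and every test costs
  one time unit. Since addition is the only operation that makes numbers grow, and lengthens them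
  by at most one bit, unit cost is polynomially related to Turing machine time; with
  multiplication at unit cost this would fail.
\<close>

datatype com =
    Skip
  | Const nat nat
  | Add nat nat nat
  | Sub nat nat nat
  | Load nat nat
  | Store nat nat
  | Seq com com
  | Cond nat com com
  | While nat com

type_synonym state = "(nat \<Rightarrow> nat) \<times> (nat \<Rightarrow> nat)"

text \<open>\<open>exec c s t s'\<close>: started in \<open>s\<close>, the program \<open>c\<close> halts in \<open>s'\<close> after \<open>t\<close> steps.\<close>

inductive exec :: "com \<Rightarrow> state \<Rightarrow> nat \<Rightarrow> state \<Rightarrow> bool" where
  Skip: "exec Skip s 1 s"
| Const: "exec (Const i k) (r, h) 1 (r(i := k), h)"
| Add: "exec (Add i j k) (r, h) 1 (r(i := r j + r k), h)"
| Sub: "exec (Sub i j k) (r, h) 1 (r(i := r j - r k), h)"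
| Load: "exec (Load i j) (r, h) 1 (r(i := h (r j)), h)"
| Store: "exec (Store i j) (r, h) 1 (r, h(r i := r j))"
| Seq: "exec c s t s' \<Longrightarrow> exec d s' t' s'' \<Longrightarrow> exec (Seq c d) s (t + t') s''"
| Cond_True: "r i \<noteq> 0 \<Longrightarrow> exec c (r, h) t s \<Longrightarrow> exec (Cond i c d) (r, h) (Suc t) s"
| Cond_False: "r i = 0 \<Longrightarrow> exec d (r, h) t s \<Longrightarrow> exec (Cond i c d) (r, h) (Suc t) s"
| While_True: "r i \<noteq> 0 \<Longrightarrow> exec c (r, h) t s \<Longrightarrow> exec (While i c) s t' s' \<Longrightarrow>
    exec (While i c) (r, h) (Suc (t + t')) s'"
| While_False: "r i = 0 \<Longrightarrow> exec (While i c) (r, h) 1 (r, h)"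

inductive_cases exec_elims:
  "exec Skip s t s'" "exec (Const i k) s t s'" "exec (Add i j k) s t s'" "exec (Sub i j k) s t s'"
  "exec (Load i j) s t s'" "exec (Store i j) s t s'" "exec (Seq c d) s t s'"
  "exec (Cond i c d) s t s'"

inductive_cases exec_WhileE: "exec (While i c) s t s'"

lemma exec_deterministic:
  "exec c s t s' \<Longrightarrow> exec c s u s'' \<Longrightarrow> u = t \<and> s'' = s'"
proof (induction arbitrary: u s'' rule: exec.induct)
  case (Seq c s t s' d t' s3)
  from Seq.prems obtain a b x where *: "exec c s a x" "exec d x b s''" "u = a + b"
    by (rule exec_elims(7)) auto
  with Seq.IH(1)[OF *(1)] Seq.IH(2) show ?case by auto
next
  case (Cond_True r i c h t s d)
  from Cond_True.prems obtain a where "exec c (r, h) a s''" "u = Suc a"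
    by (rule exec_elims(8)) (use Cond_True.hyps in auto)
  with Cond_True.IH show ?case by auto
next
  case (Cond_False r i d h t s c)
  from Cond_False.prems obtain a where "exec d (r, h) a s''" "u = Suc a"
    by (rule exec_elims(8)) (use Cond_False.hyps in auto)
  with Cond_False.IH show ?case by auto
next
  case (While_True r i c h t s t' s')
  from While_True.prems obtain a b x where
    *: "exec c (r, h) a x" "exec (While i c) x b s''" "u = Suc (a + b)"
    by (rule exec_WhileE) (use While_True.hyps in auto)
  with While_True.IH(1)[OF *(1)] While_True.IH(2) show ?case by auto
next
  case (While_False r i c h)
  from While_False.prems show ?case
    by (rule exec_WhileE) (use While_False.hyps in auto)
qed (erule exec_elims; simp)+

text \<open>Words are passed in the memory cells from address 0 on, their length in register 0; at the
  start all other cells and registers hold 0.\<close>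

definition input_state :: "nat list \<Rightarrow> state" where
  "input_state w =
    ((\<lambda>i. 0)(0 := length w), (\<lambda>a. if a < length w then w ! a else 0))"

definition output_word :: "state \<Rightarrow> nat list" where
  "output_word s = map (snd s) [0..<fst s 0]"

definition outputs :: "com \<Rightarrow> nat list \<Rightarrow> nat list \<Rightarrow> bool" where
  "outputs P w z \<longleftrightarrow> (\<exists>t s. exec P (input_state w) t s \<and> output_word s = z)"

text \<open>\<open>P\<close> halts on every input from \<open>D\<close> within a number of steps polynomial in the input length.
  A word of numbers has at least as many bits as entries, so this bound is also polynomial in the
  number of bits of the input.\<close>

definition poly_time_on :: "com \<Rightarrow> nat list set \<Rightarrow> bool" where
  "poly_time_on P D \<longleftrightarrow>
    (\<exists>q :: nat poly. \<forall>w\<in>D. \<exists>t s. exec P (input_state w) t s \<and> t \<le> poly q (length w))"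


section \<open>Encoding of grid STAR\<close>

definition encode_vertices :: "(nat \<times> nat) list \<Rightarrow> nat list" where
  "encode_vertices vs = concat (map (\<lambda>(i, j). [i, j]) vs)"

definition encode_edges :: "((nat \<times> nat) \<times> (nat \<times> nat)) list \<Rightarrow> nat list" where
  "encode_edges es = concat (map (\<lambda>(u, v). encode_vertices [u, v]) es)"

text \<open>The list contains every edge exactly once; order and orientation are arbitrary.\<close>

definition enumerates :: "('a \<times> 'a) list \<Rightarrow> 'a set set \<Rightarrow> bool" where
  "enumerates es F \<longleftrightarrow>
    distinct (map (\<lambda>(u, v). {u, v}) es) \<and> set (map (\<lambda>(u, v). {u, v}) es) = F"

text \<open>The edges of the grid are listed explicitly, so the input length is proportional to the size
  of the graph even if \<open>X\<close> is small, rather than to the number of digits of \<open>n\<close> and \<open>m\<close>.\<close>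

definition encodes :: "nat list \<Rightarrow> nat \<Rightarrow> nat \<Rightarrow> (nat \<times> nat) set set \<Rightarrow> bool" where
  "encodes w n m X \<longleftrightarrow>
    (\<exists>es xs. enumerates es (edges (grid n m)) \<and> enumerates xs X \<and>
      w = [n, m, length es] @ encode_edges es @ [length xs] @ encode_edges xs)"

definition grid_star_inputs :: "nat list set" where
  "grid_star_inputs = {w. \<exists>n m X. star_instance (grid n m) X \<and> encodes w n m X}"

definition solves_grid_star :: "com \<Rightarrow> bool" where
  "solves_grid_star P \<longleftrightarrow>
    (\<forall>n m X w. star_instance (grid n m) X \<and> encodes w n m X \<longrightarrow>
      (\<exists>p. outputs P w (encode_vertices p) \<and> closed_walk (grid n m) p \<and> covers p X))"

end

theory Submission
  imports Defs
begin

text \<open>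
  The algorithm ignores \<open>X\<close>: it traverses the rows of the grid alternately rightwards and
  leftwards and then returns to the corner, a closed walk through all vertices of length at most
  \<open>nm + n + m\<close>. Conversely, let \<open>W\<close> be the set of vertices of a closed walk covering \<open>X\<close> and \<open>U\<close>
  its complement. Edges inside \<open>U\<close> are not in \<open>X\<close>, so there are only few of them, and at least
  \<open>|W| - 1\<close> edges lie inside \<open>W\<close>. Since all but \<open>O(n + m)\<close> vertices have degree 4, the degree sum
  over \<open>U\<close>, which is \<open>|E| + e(U) - e(W)\<close>, is at least \<open>4|U| - O(n + m)\<close>. With \<open>|E| \<le> 2nm\<close> and
  \<open>|U| = nm - |W|\<close> this yields \<open>|W| \<ge> (2/3 - o(1)) nm\<close>.
\<close>

section \<open>Grid graphs\<close>

lemma verts_grid: "verts (grid n m) = {..<n} \<times> {..<m}"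
  by (simp add: grid_def box_product_def path_graph_def)

lemma edges_grid:
  "edges (grid n m) =
    (\<lambda>(i, j). {(i, j), (Suc i, j)}) ` ({..<n - 1} \<times> {..<m}) \<union>
    (\<lambda>(i, j). {(i, j), (i, Suc j)}) ` ({..<n} \<times> {..<m - 1})"
    (is "_ = ?V \<union> ?H")
proof -
  \<comment> \<open>Written as an image of \<open>{u, v}\<close>, the product edge no longer depends
    on which end is named first, so \<open>{i, Suc i}\<close> can be substituted for
    \<open>{u, v}\<close> without a case split.\<close>
  have col: "{(u, x), (v, x)} = (\<lambda>t. (t, x)) ` {u, v}" for u v x :: nat
    by simp
  have row: "{(u, x), (u, y)} = Pair u ` {x, y}" for u x y :: nat
    by simp
  have "{{(u, x), (v, x)} | u v x. {u, v} \<in> edges (path_graph n) \<and> x \<in> verts (path_graph m)} =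
      {(\<lambda>t. (t, x)) ` {i, Suc i} | i x. Suc i < n \<and> x < m}"
    unfolding path_graph_def col by (simp, blast)
  also have "\<dots> = ?V"
    by (fastforce simp: less_diff_conv)
  finally have "{{(u, x), (v, x)} | u v x. {u, v} \<in> edges (path_graph n) \<and> x \<in> verts (path_graph m)} = ?V" .
  moreover have "{{(u, x), (u, y)} | u x y. u \<in> verts (path_graph n) \<and> {x, y} \<in> edges (path_graph m)} =
      {Pair u ` {j, Suc j} | u j. u < n \<and> Suc j < m}"
    unfolding path_graph_def row by (simp, blast)
  moreover have "\<dots> = ?H"
    by (fastforce simp: less_diff_conv)
  ultimately show ?thesis
    by (simp add: grid_def box_product_def)
qed

lemma finite_edges_grid [simp]: "finite (edges (grid n m))"
  by (simp add: edges_grid)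

lemma card_edges_grid: "card (edges (grid n m)) = (n - 1) * m + n * (m - 1)"
proof -
  have "card ((\<lambda>(i, j). {(i, j), (Suc i, j)}) ` ({..<n - 1} \<times> {..<m})) = (n - 1) * m"
    by (subst card_image) (auto simp: inj_on_def doubleton_eq_iff)
  moreover have "card ((\<lambda>(i, j). {(i, j), (i, Suc j)}) ` ({..<n} \<times> {..<m - 1})) = n * (m - 1)"
    by (subst card_image) (auto simp: inj_on_def doubleton_eq_iff)
  ultimately show ?thesis
    unfolding edges_grid by (subst card_Un_disjoint) (auto simp: doubleton_eq_iff)
qed

lemma card_edges_grid_le: "card (edges (grid n m)) \<le> 2 * (n * m)"
proof -
  have "(n - 1) * m \<le> n * m" "n * (m - 1) \<le> n * m"
    by simp_all
  then show ?thesis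
    unfolding card_edges_grid by linarith
qed

lemma edge_gridE:
  assumes "e \<in> edges (grid n m)"
  obtains u v where "e = {u, v}" "u \<noteq> v" "u \<in> verts (grid n m)" "v \<in> verts (grid n m)"
  using assms by (fastforce simp: edges_grid verts_grid less_diff_conv)

lemma vertical_edge:
  assumes "Suc i < n" "j < m"
  shows "{(i, j), (Suc i, j)} \<in> edges (grid n m)" "{(Suc i, j), (i, j)} \<in> edges (grid n m)"
proof -
  show "{(i, j), (Suc i, j)} \<in> edges (grid n m)"
    unfolding edges_grid using assms by (intro UnI1 image_eqI[of _ _ "(i, j)"]) auto
  then show "{(Suc i, j), (i, j)} \<in> edges (grid n m)"
    by (simp only: insert_commute)
qed

lemma horizontal_edge:
  assumes "i < n" "Suc j < m"
  shows "{(i, j), (i, Suc j)} \<in> edges (grid n m)" "{(i, Suc j), (i, j)} \<in> edges (grid n m)"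
proof -
  show "{(i, j), (i, Suc j)} \<in> edges (grid n m)"
    unfolding edges_grid using assms by (intro UnI2 image_eqI[of _ _ "(i, j)"]) auto
  then show "{(i, Suc j), (i, j)} \<in> edges (grid n m)"
    by (simp only: insert_commute)
qed

lemma star_instance_grid_pos:
  assumes "star_instance (grid n m) X"
  shows "n > 0" "m > 0"
  using assms by (auto simp: star_instance_def edges_grid)

section \<open>Vertex degrees and their sum over a vertex set\<close>

lemma degree_interior:
  assumes "Suc i < n" "Suc j < m" "i > 0" "j > 0"
  shows "card {e \<in> edges (grid n m). (i, j) \<in> e} \<ge> 4"
proof -
  let ?F = "{{(i, j), (Suc i, j)}, {(i - 1, j), (i, j)}, {(i, j), (i, Suc j)}, {(i, j - 1), (i, j)}}"
  from assms have "card ?F = 4"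
    by (auto simp: card_insert_if doubleton_eq_iff)
  moreover have "?F \<subseteq> {e \<in> edges (grid n m). (i, j) \<in> e}"
    using assms vertical_edge[of i n j m] vertical_edge[of "i - 1" n j m]
      horizontal_edge[of i n j m] horizontal_edge[of i n "j - 1" m] by auto
  then have "card ?F \<le> card {e \<in> edges (grid n m). (i, j) \<in> e}"
    by (intro card_mono) simp_all
  ultimately show ?thesis
    by linarith
qed

text \<open>Only boundary vertices can have degree below 4. There are at most
  \<open>2 * (n + m)\<close> of them, and each lowers the sum by at most 4.\<close>

lemma degree_sum:
  assumes "U \<subseteq> verts (grid n m)"
  shows "4 * card U \<le> (\<Sum>u\<in>U. card {e \<in> edges (grid n m). u \<in> e}) + 8 * (n + m)"
proof -
  define B where "B = {0, n - 1} \<times> {..<m} \<union> {..<n} \<times> {0, m - 1}"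
  have fin: "finite U" "finite B"
    using assms finite_subset by (auto simp: verts_grid B_def)
  \<comment> \<open>Only an inequality, because the first and the last row or column coincide when
    \<open>k = 0\<close>.\<close>
  have card2: "card {0, k} \<le> 2" for k :: nat
    by (simp add: card_insert_if)
  have "card B \<le> card ({0, n - 1} \<times> {..<m}) + card ({..<n} \<times> {0, m - 1})"
    unfolding B_def by (rule card_Un_le)
  also have "\<dots> \<le> 2 * m + n * 2"
    unfolding card_cartesian_product card_lessThan
    by (intro add_mono mult_le_mono card2 order.refl)
  finally have cardB: "card B \<le> 2 * (n + m)"
    by simp
  have "card U \<le> card (U - B) + card B"
    using fin by (metis card_mono card_Un_le finite_Diff finite_UnI le_trans Un_Diff_cancel2 Un_upper1)
  then have "4 * card U \<le> (\<Sum>u\<in>U - B. 4) + 8 * (n + m)"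
    using cardB by simp
  also have "(\<Sum>u\<in>U - B. 4) \<le> (\<Sum>u\<in>U - B. card {e \<in> edges (grid n m). u \<in> e})"
  proof (rule sum_mono)
    fix u
    assume "u \<in> U - B"
    moreover obtain i j where "u = (i, j)"
      by (cases u)
    ultimately have "Suc i < n" "Suc j < m" "i > 0" "j > 0" "u = (i, j)"
      using assms by (auto simp: B_def verts_grid)
    then show "4 \<le> card {e \<in> edges (grid n m). u \<in> e}"
      using degree_interior by simp
  qed
  also have "\<dots> \<le> (\<Sum>u\<in>U. card {e \<in> edges (grid n m). u \<in> e})"
    using fin by (intro sum_mono2) auto
  finally show ?thesis
    by simp
qed


section \<open>Lower bound\<close>

text \<open>Prepending a new vertex \<open>x\<close> to a walk starting at \<open>y\<close> brings
  in the edge \<open>{x, y}\<close>, which was not inside the old vertex set; prepending a repeated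
  vertex leaves that set unchanged.\<close>

lemma walk_spans_edges:
  assumes "finite E" "successively (\<lambda>u v. {u, v} \<in> E) p"
  shows "card (set p) \<le> Suc (card {e \<in> E. e \<subseteq> set p})"
  using assms(2)
proof (induction p rule: induct_list012)
  case (3 x y q)
  then have IH: "card (set (y # q)) \<le> Suc (card {e \<in> E. e \<subseteq> set (y # q)})" and xy: "{x, y} \<in> E"
    by auto
  show ?case
  proof (cases "x \<in> set (y # q)")
    case True
    then have "set (x # y # q) = set (y # q)"
      by auto
    with IH show ?thesis
      by simp
  next
    case False
    have "Suc (card {e \<in> E. e \<subseteq> set (y # q)}) = card (insert {x, y} {e \<in> E. e \<subseteq> set (y # q)})"
      using False assms(1) by (subst card_insert_disjoint) auto
    also have "\<dots> \<le> card {e \<in> E. e \<subseteq> set (x # y # q)}"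
      using assms(1) xy by (intro card_mono) auto
    finally show ?thesis
      using IH False by (simp add: card_insert_if)
  qed
qed auto

lemma closed_walk_iff_successively:
  "closed_walk G p \<longleftrightarrow>
    p \<noteq> [] \<and> set p \<subseteq> verts G \<and> successively (\<lambda>u v. {u, v} \<in> edges G) p \<and> hd p = last p"
  by (simp add: closed_walk_def successively_conv_nth)

text \<open>In the final estimate |W| occurs four times through 4|U| and once, with opposite sign,
  through e(W). The additive \<open>4\<close> is 1 from |W| - 1 \<le> e(W) plus 3 from three uses of
  |W| \<le> \<open>walk_length p + 1\<close>.\<close>

lemma covering_walk_length:
  assumes walk: "closed_walk (grid n m) p" and cov: "covers p X"
  shows "2 * (n * m) \<le> 3 * walk_length p + 8 * (n + m) + 4 + card (edges (grid n m) - X)"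
proof -
  define E W U where "E = edges (grid n m)" and "W = set p" and "U = verts (grid n m) - W"
  have fin: "finite E" "finite U" "finite W"
    by (simp_all add: E_def U_def W_def verts_grid)
  have W: "W \<subseteq> verts (grid n m)"
    using walk by (simp add: closed_walk_def W_def)
  then have cardV: "card U + card W = n * m"
    unfolding U_def using card_mono[OF _ W]
    by (simp add: card_Diff_subset W_def verts_grid)
  have "4 * card U \<le> (\<Sum>u\<in>U. card {e \<in> E. u \<in> e}) + 8 * (n + m)"
    unfolding E_def by (rule degree_sum) (auto simp: U_def)
  moreover have "(\<Sum>u\<in>U. card {e \<in> E. u \<in> e}) = (\<Sum>e\<in>E. card {u \<in> U. u \<in> e})"
    using fin by (intro sum_multicount_gen) auto
  \<comment> \<open>An edge has 0, 1 or 2 ends in \<open>U\<close>, and the extreme cases are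
    exactly \<open>e \<subseteq> W\<close> and \<open>e \<subseteq> U\<close>. Keeping the former on
    the left avoids truncated subtraction.\<close>
  moreover have "(\<Sum>e\<in>E. card {u \<in> U. u \<in> e} + of_bool (e \<subseteq> W)) = (\<Sum>e\<in>E. 1 + of_bool (e \<subseteq> U))"
  proof (rule sum.cong)
    fix e
    assume "e \<in> E"
    then obtain u v where e: "e = {u, v}" "u \<noteq> v" "u \<in> verts (grid n m)" "v \<in> verts (grid n m)"
      unfolding E_def by (rule edge_gridE)
    have "{x \<in> U. x \<in> e} = (if u \<in> U then {u} else {}) \<union> (if v \<in> U then {v} else {})"
      using e by auto
    then show "card {x \<in> U. x \<in> e} + of_bool (e \<subseteq> W) = 1 + of_bool (e \<subseteq> U)"
      using e by (auto simp: U_def)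
  qed simp
  then have "(\<Sum>e\<in>E. card {u \<in> U. u \<in> e}) + card {e \<in> E. e \<subseteq> W} = card E + card {e \<in> E. e \<subseteq> U}"
    using fin by (simp add: sum.distrib sum_of_bool_eq Int_def del: One_nat_def sum_Suc)
  \<comment> \<open>The walk visits no end of an edge inside \<open>U\<close>, so such an edge
    cannot lie in the covered set \<open>X\<close>.\<close>
  moreover have "card {e \<in> E. e \<subseteq> U} \<le> card (E - X)"
    using fin cov by (intro card_mono) (auto simp: covers_def U_def W_def)
  moreover have "card W \<le> Suc (card {e \<in> E. e \<subseteq> W})"
    unfolding W_def using walk fin by (intro walk_spans_edges) (auto simp: closed_walk_iff_successively E_def)
  moreover have "card E \<le> 2 * (n * m)"
    unfolding E_def by (rule card_edges_grid_le)
  moreover have "card W \<le> Suc (walk_length p)"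
    using card_length[of p] by (simp add: W_def walk_length_def)
  ultimately show ?thesis
    using cardV unfolding E_def by linarith
qed


section \<open>The traversal\<close>

text \<open>The argument \<open>j\<close> is the position in the order of visit, not the column. The
  flip in odd rows makes each row start in the column where the previous one ended.\<close>

definition snake :: "nat \<Rightarrow> nat \<Rightarrow> nat \<Rightarrow> nat \<times> nat" where
  "snake m i j = (i, if even i then j else m - 1 - j)"

definition snake_rows :: "nat \<Rightarrow> nat \<Rightarrow> (nat \<times> nat) list" where
  "snake_rows m n = concat (map (\<lambda>i. map (snake m i) [0..<m]) [0..<n])"

text \<open>The second part runs left along the last row and is empty if that row was already
  traversed leftwards; the third returns along column 0. Both omit their starting vertex, at which
  the walk so far ends.\<close>

definition traversal :: "nat \<Rightarrow> nat \<Rightarrow> (nat \<times> nat) list" where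
  "traversal n m =
    snake_rows m n @
    map (Pair (n - 1)) (rev [0..<snd (snake m (n - 1) (m - 1))]) @
    map (\<lambda>i. (i, 0)) (rev [0..<n - 1])"

lemma Pair_snd_snake: "(i, snd (snake m i j)) = snake m i j"
  by (simp add: snake_def)

lemma snake_rows_0 [simp]: "snake_rows m 0 = []"
  by (simp add: snake_rows_def)

lemma snake_rows_Suc: "snake_rows m (Suc n) = snake_rows m n @ map (snake m n) [0..<m]"
  by (simp add: snake_rows_def)

lemma length_snake_rows: "length (snake_rows m n) = n * m"
  by (induction n) (simp_all add: snake_rows_Suc)

lemma snake_rows_ends:
  assumes "m > 0" "n > 0"
  shows "hd (snake_rows m n) = (0, 0)" "last (snake_rows m n) = snake m (n - 1) (m - 1)"
    "snake_rows m n \<noteq> []"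
proof -
  show "snake_rows m n \<noteq> []"
    using assms length_snake_rows[of m n] by fastforce
  show "last (snake_rows m n) = snake m (n - 1) (m - 1)"
    using assms by (cases n) (simp_all add: snake_rows_Suc last_map)
  have "hd (snake_rows m (Suc k)) = (0, 0)" for k
  proof (induction k)
    case 0
    then show ?case
      using assms by (simp add: snake_rows_Suc hd_map snake_def)
  next
    case (Suc k)
    then show ?case
      using assms by (subst snake_rows_Suc) (auto simp: hd_append dest: arg_cong[of _ _ length] simp: length_snake_rows)
  qed
  then show "hd (snake_rows m n) = (0, 0)"
    using assms by (cases n) simp_all
qed

lemma set_snake_rows: "set (snake_rows m n) = {..<n} \<times> {..<m}"
proof (induction n)
  case (Suc n)
  have "\<exists>i\<in>{0..<m}. j = m - Suc i" if "j < m" for j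
    using that by (intro bexI[of _ "m - Suc j"]) auto
  then have "snake m n ` {0..<m} = {n} \<times> {..<m}"
    by (cases "even n") (auto simp: snake_def image_iff)
  with Suc show ?case
    by (auto simp: snake_rows_Suc lessThan_Suc)
qed simp

text \<open>The number \<open>k\<close> of rows visited is kept apart from the height
  \<open>n\<close>, so that the induction stays inside one grid.\<close>

lemma successively_snake_rows:
  assumes "m > 0" "k \<le> n"
  shows "successively (\<lambda>u v. {u, v} \<in> edges (grid n m)) (snake_rows m k)"
  using assms(2)
proof (induction k)
  case (Suc k)
  have "successively (\<lambda>u v. {u, v} \<in> edges (grid n m)) (map (snake m k) [0..<m])"
    unfolding successively_conv_nth
  proof (intro allI impI)
    fix j
    assume "Suc j < length (map (snake m k) [0..<m])"
    then have j: "Suc j < m"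
      by simp
    then have "m - 1 - j = Suc (m - 1 - Suc j)" "Suc (m - 1 - Suc j) < m"
      by auto
    then show "{map (snake m k) [0..<m] ! j, map (snake m k) [0..<m] ! Suc j} \<in> edges (grid n m)"
      using j Suc.prems horizontal_edge[of k n j m] horizontal_edge[of k n "m - 1 - Suc j" m]
      by (simp add: snake_def)
  qed
  moreover have "{last (snake_rows m k), hd (map (snake m k) [0..<m])} \<in> edges (grid n m)" if "k > 0"
    using that assms(1) Suc.prems vertical_edge[of "k - 1" n _ m] snake_rows_ends[of m k]
    by (auto simp: snake_def hd_map)
  ultimately show ?case
    using Suc by (cases "k = 0") (auto simp: snake_rows_Suc successively_append_iff)
qed simp

lemma traversal_walk:
  assumes "n > 0" "m > 0"
  shows "closed_walk (grid n m) (traversal n m)"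
proof -
  let ?P = "\<lambda>u v. {u, v} \<in> edges (grid n m)"
  let ?c = "snd (snake m (n - 1) (m - 1))"
  have c: "?c < m"
    using assms by (simp add: snake_def)
  define ps where "ps = map (Pair (n - 1)) (rev [0..<?c])"
  define qs where "qs = map (\<lambda>i. (i, 0 :: nat)) (rev [0..<n - 1])"
  \<comment> \<open>With the end of the preceding part put in front, the edge joining the two parts
    is just one more step of a straight path. The same is done for \<open>qs\<close>.\<close>
  have ps: "(n - 1, ?c) # ps = map (Pair (n - 1)) (rev [0..<Suc ?c])"
    by (simp add: ps_def)
  have "successively ?P ((n - 1, ?c) # ps)"
    unfolding ps using assms c horizontal_edge[of "n - 1" n _ m]
    by (simp only: successively_map successively_rev)
      (auto simp: successively_conv_nth simp del: upt_Suc)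
  moreover have "last ((n - 1, ?c) # ps) = (n - 1, 0)"
    by (cases ?c) (simp_all add: ps_def last_map last_rev hd_append del: upt_Suc)
  moreover have qs: "(n - 1, 0) # qs = map (\<lambda>i. (i, 0)) (rev [0..<Suc (n - 1)])"
    by (simp add: qs_def)
  have "successively ?P ((n - 1, 0) # qs)"
    unfolding qs using assms vertical_edge[of _ n 0 m]
    by (simp only: successively_map successively_rev)
      (auto simp: successively_conv_nth simp del: upt_Suc)
  moreover have "last ((n - 1, 0) # qs) = (0, 0)"
    by (cases "n - 1") (simp_all add: qs_def last_map last_rev hd_append del: upt_Suc)
  moreover have rows: "set (snake_rows m n) = {..<n} \<times> {..<m}" "snake_rows m n \<noteq> []"
    "hd (snake_rows m n) = (0, 0)" "last (snake_rows m n) = (n - 1, ?c)"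
    "successively ?P (snake_rows m n)"
    using assms by (simp_all add: snake_rows_ends set_snake_rows successively_snake_rows snake_def)
  moreover have "set ps \<subseteq> {..<n} \<times> {..<m}" "set qs \<subseteq> {..<n} \<times> {..<m}"
    using assms c by (auto simp: ps_def qs_def)
  moreover have "traversal n m = snake_rows m n @ ps @ qs"
    by (simp add: traversal_def ps_def qs_def)
  ultimately show ?thesis
    unfolding closed_walk_iff_successively
    by (auto simp: successively_append_iff successively_Cons verts_grid split: if_splits)
qed

lemma traversal_covers:
  assumes "star_instance (grid n m) X"
  shows "covers (traversal n m) X"
  unfolding covers_def
proof
  fix e
  assume "e \<in> X"
  then have "e \<in> edges (grid n m)"
    using assms by (auto simp: star_instance_def)
  then obtain u v where "e = {u, v}" "u \<in> verts (grid n m)"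
    by (rule edge_gridE)
  then show "\<exists>v\<in>set (traversal n m). v \<in> e"
    by (auto simp: traversal_def set_snake_rows verts_grid)
qed

lemma traversal_length:
  "walk_length (traversal n m) \<le> n * m + n + m"
proof -
  have "snd (snake m (n - 1) (m - 1)) \<le> m"
    by (simp add: snake_def)
  then show ?thesis
    by (simp add: traversal_def walk_length_def length_snake_rows)
qed


section \<open>The program\<close>

text \<open>Total correctness: a halting run must exist. The postcondition also receives the number
  of steps, so output and running time are verified together.\<close>

definition wp :: "com \<Rightarrow> (nat \<Rightarrow> state \<Rightarrow> bool) \<Rightarrow> state \<Rightarrow> bool" where
  "wp c Q s \<longleftrightarrow> (\<exists>t s'. exec c s t s' \<and> Q t s')"

lemma wp_basic:
  "Q 1 (r(i := k), h) \<Longrightarrow> wp (Const i k) Q (r, h)"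
  "Q 1 (r(i := r j + r k), h) \<Longrightarrow> wp (Add i j k) Q (r, h)"
  "Q 1 (r(i := r j - r k), h) \<Longrightarrow> wp (Sub i j k) Q (r, h)"
  "Q 1 (r(i := h (r j)), h) \<Longrightarrow> wp (Load i j) Q (r, h)"
  "Q 1 (r, h(r i := r j)) \<Longrightarrow> wp (Store i j) Q (r, h)"
  unfolding wp_def by (blast intro: exec.intros)+

lemma wp_Seq: "wp c (\<lambda>t. wp d (\<lambda>u. Q (t + u))) s \<Longrightarrow> wp (Seq c d) Q s"
  unfolding wp_def by (blast intro: exec.Seq)

lemma wp_Cond:
  "\<lbrakk>r i \<noteq> 0 \<Longrightarrow> wp c (\<lambda>t. Q (Suc t)) (r, h); r i = 0 \<Longrightarrow> wp d (\<lambda>t. Q (Suc t)) (r, h)\<rbrakk>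
    \<Longrightarrow> wp (Cond i c d) Q (r, h)"
  unfolding wp_def by (cases "r i = 0") (blast intro: exec.intros)+

lemma wp_mono: "wp c Q s \<Longrightarrow> (\<And>t s'. Q t s' \<Longrightarrow> R t s') \<Longrightarrow> wp c R s"
  unfolding wp_def by blast

text \<open>The index of the invariant equals the tested register and counts the remaining
  iterations, so induction on it gives termination. An iteration costs one step for the test plus at
  most \<open>T\<close>; the final failing test costs one more.\<close>

lemma wp_While:
  assumes "I k s"
    and test: "\<And>k r h. I k (r, h) \<Longrightarrow> r i = k"
    and body: "\<And>k r h. I (Suc k) (r, h) \<Longrightarrow> wp c (\<lambda>t s. t \<le> T \<and> I k s) (r, h)"
  shows "wp (While i c) (\<lambda>t s. t \<le> Suc (k * Suc T) \<and> I 0 s) s"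
  using assms(1)
proof (induction k arbitrary: s)
  case 0
  moreover obtain r h where "s = (r, h)"
    by (cases s)
  ultimately show ?case
    using test[of 0 r h] unfolding wp_def by (fastforce intro: exec.While_False)
next
  case (Suc k)
  moreover obtain r h where s: "s = (r, h)"
    by (cases s)
  ultimately have "wp c (\<lambda>t s. t \<le> T \<and> I k s) (r, h)"
    by (auto intro: body)
  then obtain t s' where first: "exec c (r, h) t s'" "t \<le> T" "I k s'"
    unfolding wp_def by blast
  from Suc.IH[OF first(3)] obtain u s''
    where rest: "exec (While i c) s' u s''" "u \<le> Suc (k * Suc T)" "I 0 s''"
    unfolding wp_def by blast
  have "r i \<noteq> 0"
    using test[of "Suc k" r h] Suc.prems s by simp
  then have "exec (While i c) s (Suc (t + u)) s''"
    unfolding s using first(1) rest(1) by (rule exec.While_True)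
  with first(2) rest(2,3) show ?case
    unfolding wp_def by (intro exI[of _ "Suc (t + u)"] exI[of _ s'']) simp
qed

text \<open>Register 0 always points to the first free output cell, so that the output has the required
  format at any time. Register 3 holds the constant 1.\<close>

definition emit :: "nat \<Rightarrow> nat \<Rightarrow> com" where
  "emit i j = Seq (Store 0 i) (Seq (Add 0 0 3) (Seq (Store 0 j) (Add 0 0 3)))"

definition written :: "(nat \<times> nat) list \<Rightarrow> state \<Rightarrow> bool" where
  "written vs s \<longleftrightarrow> output_word s = encode_vertices vs"

text \<open>Quantifying over \<open>h'\<close> forgets the exact memory contents and keeps only the
  output. The emitted registers differ from register 0, which moves between the two stores.\<close>

lemma wp_emit:
  assumes "r 3 = 1" "i \<noteq> 0" "j \<noteq> 0" "written vs (r, h)"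
    and "\<And>h'. written (vs @ [(r i, r j)]) (r(0 := r 0 + 2), h') \<Longrightarrow> Q 4 (r(0 := r 0 + 2), h')"
  shows "wp (emit i j) Q (r, h)"
proof -
  \<comment> \<open>Both new cells lie just beyond the output written so far.\<close>
  have "map (h(r 0 := r i, Suc (r 0) := r j)) [0..<r 0] = map h [0..<r 0]"
    by simp
  then have "written (vs @ [(r i, r j)]) (r(0 := r 0 + 2), h(r 0 := r i, Suc (r 0) := r j))"
    using assms(4) by (simp add: written_def output_word_def encode_vertices_def)
  from assms(5)[OF this] show ?thesis
    using assms(1-3) unfolding emit_def
    by (intro wp_Seq wp_basic) (simp add: numeral_eq_Suc)
qed

lemma written_cong: "written vs (r, h) \<Longrightarrow> r' 0 = r 0 \<Longrightarrow> written vs (r', h)"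
  by (simp add: written_def output_word_def)

text \<open>Registers: 1 rows still to be traversed, 2 number of columns, 4 current row, 5 its parity,
  6 vertices of the row still to be visited, 7 current column, 8 the constant 0.\<close>

definition row_step :: com where
  "row_step = Seq (Cond 5 (Sub 7 6 3) (Sub 7 2 6)) (Seq (emit 4 7) (Sub 6 6 3))"

text \<open>Adding the constant 0 in register 8 copies the number of columns;
  \<open>Sub 5 3 5\<close> flips the parity.\<close>

definition rows_step :: com where
  "rows_step =
    Seq (Add 6 2 8) (Seq (While 6 row_step) (Seq (Sub 5 3 5) (Seq (Add 4 4 3) (Sub 1 1 3))))"

text \<open>The output overwrites the input, but only after \<open>n\<close> and \<open>m\<close>
  have been loaded. The 0 in register 0 is first the address of \<open>n\<close> and then the output
  pointer; the constant 1 also serves as the address of \<open>m\<close>.\<close>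

definition traverse :: com where
  "traverse =
    Seq (Const 0 0) (Seq (Load 1 0) (Seq (Const 3 1) (Seq (Load 2 3)
    (Seq (While 1 rows_step)
    (Seq (Sub 4 4 3)
    (Seq (While 7 (Seq (Sub 7 7 3) (emit 4 7)))
         (While 4 (Seq (Sub 4 4 3) (emit 4 7)))))))))"

section \<open>Loop invariants and verification of the program\<close>

text \<open>Here \<open>c\<close> vertices of row \<open>i\<close> remain to be visited. Register 7
  holds a column of this row only after its first vertex, hence the guard
  \<open>c < m\<close>.\<close>

definition row_inv :: "nat \<Rightarrow> nat \<Rightarrow> nat \<Rightarrow> nat \<Rightarrow> state \<Rightarrow> bool" where
  "row_inv m k i c s \<longleftrightarrow> (case s of (r, h) \<Rightarrow>
    r 1 = k \<and> r 2 = m \<and> r 3 = 1 \<and> r 4 = i \<and> r 5 = i mod 2 \<and> r 6 = c \<and> r 8 = 0 \<and> c \<le> m \<and>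
    (c < m \<longrightarrow> r 7 = snd (snake m i (m - 1 - c))) \<and>
    written (snake_rows m i @ map (snake m i) [0..<m - c]) s)"

text \<open>At \<open>k = 0\<close> and for positive \<open>n\<close>, register 7 holds the column
  in which the last row ended, where the way back starts.\<close>

definition rows_inv :: "nat \<Rightarrow> nat \<Rightarrow> nat \<Rightarrow> state \<Rightarrow> bool" where
  "rows_inv n m k s \<longleftrightarrow> (case s of (r, h) \<Rightarrow>
    r 1 = k \<and> r 2 = m \<and> r 3 = 1 \<and> r 4 = n - k \<and> r 5 = (n - k) mod 2 \<and> r 8 = 0 \<and> k \<le> n \<and>
    (k < n \<longrightarrow> r 7 = snd (snake m (n - k - 1) (m - 1))) \<and>
    written (snake_rows m (n - k)) s)"

lemma row_inv_reg: "row_inv m k i c (r, h) \<Longrightarrow> r 6 = c"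
  by (simp add: row_inv_def)

lemma rows_inv_reg: "rows_inv n m k (r, h) \<Longrightarrow> r 1 = k"
  by (simp add: rows_inv_def)

lemma wp_row_step:
  assumes "row_inv m k i (Suc c) (r, h)"
  shows "wp row_step (\<lambda>t s. t \<le> 7 \<and> row_inv m k i c s) (r, h)"
proof -
  let ?j = "snd (snake m i (m - Suc c))"
  have *: "r 6 = Suc c" "r 3 = 1" "r 2 = m" "r 5 = i mod 2" "r 4 = i" "c < m"
    "written (snake_rows m i @ map (snake m i) [0..<m - Suc c]) (r, h)"
    using assms by (auto simp: row_inv_def)
  have "[0..<m - c] = [0..<m - Suc c] @ [m - Suc c]"
    using *(6) by (simp flip: upt_Suc_append add: Suc_diff_Suc)
  then have emit: "wp (Seq (emit 4 7) (Sub 6 6 3)) (\<lambda>t s. t \<le> 5 \<and> row_inv m k i c s) (r(7 := ?j), h)"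
    using assms
    by (intro wp_Seq wp_emit[where vs = "snake_rows m i @ map (snake m i) [0..<m - Suc c]"] wp_basic)
      (auto simp: row_inv_def Pair_snd_snake elim!: written_cong)
  \<comment> \<open>The next position is \<open>m - Suc c\<close>: this is the column
    \<open>m - r 6\<close> in an even row, and its mirror image is \<open>c = r 6 - 1\<close> in an
    odd one.\<close>
  have "?j = (if r 5 = 0 then r 2 - r 6 else r 6 - r 3)"
    using * by (auto simp: snake_def)
  with emit have
    "wp (Seq (emit 4 7) (Sub 6 6 3)) (\<lambda>t s. t \<le> 5 \<and> row_inv m k i c s)
      (r(7 := if r 5 = 0 then r 2 - r 6 else r 6 - r 3), h)"
    by simp
  note emit = wp_mono[OF this]
  show ?thesis
    unfolding row_step_def
    by (rule wp_Seq, rule wp_Cond; rule wp_basic) (use emit in auto)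
qed

text \<open>The bound is 1 for the copy, \<open>8 * m + 1\<close> for the inner loop and 3 for the
  updates. As \<open>m > 0\<close>, the row has set register 7.\<close>

lemma wp_rows_step:
  assumes "rows_inv n m (Suc k) (r, h)" "m > 0"
  shows "wp rows_step (\<lambda>t s. t \<le> 8 * m + 5 \<and> rows_inv n m k s) (r, h)"
proof -
  let ?i = "n - Suc k"
  have inv: "row_inv m (Suc k) ?i m (r(6 := r 2 + r 8), h)"
    using assms by (auto simp: rows_inv_def row_inv_def elim: written_cong)
  have inner: "wp (While 6 row_step) (\<lambda>t s. t \<le> Suc (m * Suc 7) \<and> row_inv m (Suc k) ?i 0 s)
      (r(6 := r 2 + r 8), h)"
    by (rule wp_While[where I = "row_inv m (Suc k) ?i", OF inv])
      (auto dest: row_inv_reg intro!: wp_row_step)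
  have rest: "wp (Seq (Sub 5 3 5) (Seq (Add 4 4 3) (Sub 1 1 3)))
      (\<lambda>t s. t \<le> 3 \<and> rows_inv n m k s) s" if "row_inv m (Suc k) ?i 0 s" for s
  proof -
    obtain r h where "s = (r, h)"
      by (cases s)
    moreover have "Suc k \<le> n" "n - k = Suc ?i"
      using assms(1) by (auto simp: rows_inv_def)
    ultimately show ?thesis
      using that assms(2) by (auto intro!: wp_Seq wp_basic
        simp: row_inv_def rows_inv_def snake_rows_Suc mod_Suc elim!: written_cong)
  qed
  show ?thesis
    unfolding rows_step_def
    by (rule wp_Seq, rule wp_basic, rule wp_Seq, rule wp_mono[OF inner])
      (auto intro!: wp_mono[OF rest] simp del: One_nat_def)
qed

lemma wp_traverse:
  assumes "h 0 = n" "h 1 = m" "n > 0" "m > 0" "\<And>i. i > 0 \<Longrightarrow> r i = 0"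
  shows "wp traverse (\<lambda>t s. t \<le> 20 * (n + 1) * (m + 1) \<and> written (traversal n m) s) (r, h)"
proof -
  let ?c = "snd (snake m (n - 1) (m - 1))"
  \<comment> \<open>On the way back the loop counter, register 7 and then register 4, is itself the
    changing coordinate of the vertex reached.\<close>
  define left_inv where "left_inv c s \<longleftrightarrow> (case s of (r, h) \<Rightarrow>
      r 3 = 1 \<and> r 4 = n - 1 \<and> r 7 = c \<and> c \<le> ?c \<and>
      written (snake_rows m n @ map (Pair (n - 1)) (rev [c..<?c])) s)" for c and s :: state
  define up_inv where "up_inv i s \<longleftrightarrow> (case s of (r, h) \<Rightarrow>
      r 3 = 1 \<and> r 4 = i \<and> r 7 = 0 \<and> i \<le> n - 1 \<and>
      written (snake_rows m n @ map (Pair (n - 1)) (rev [0..<?c]) @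
        map (\<lambda>i. (i, 0)) (rev [i..<n - 1])) s)" for i and s :: state
  have rows: "wp (While 1 rows_step) (\<lambda>t s. t \<le> Suc (n * Suc (8 * m + 5)) \<and> rows_inv n m 0 s) s"
    if "rows_inv n m n s" for s
    by (rule wp_While[where I = "rows_inv n m", OF that]) (auto dest: rows_inv_reg intro!: wp_rows_step assms(4))
  have left: "wp (While 7 (Seq (Sub 7 7 3) (emit 4 7)))
      (\<lambda>t s. t \<le> Suc (?c * Suc 5) \<and> left_inv 0 s) s" if "left_inv ?c s" for s
    using that
  proof (rule wp_While)
    fix c r h
    assume inv: "left_inv (Suc c) (r, h)"
    then have "rev [c..<?c] = rev [Suc c..<?c] @ [c]"
      by (simp add: left_inv_def upt_conv_Cons)
    with inv show "wp (Seq (Sub 7 7 3) (emit 4 7)) (\<lambda>t s. t \<le> 5 \<and> left_inv c s) (r, h)"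
      by (intro wp_Seq wp_basic
          wp_emit[where vs = "snake_rows m n @ map (Pair (n - 1)) (rev [Suc c..<?c])"])
        (auto simp: left_inv_def elim!: written_cong)
  qed (simp add: left_inv_def)
  have up: "wp (While 4 (Seq (Sub 4 4 3) (emit 4 7)))
      (\<lambda>t s. t \<le> Suc ((n - 1) * Suc 5) \<and> up_inv 0 s) s" if "up_inv (n - 1) s" for s
    using that
  proof (rule wp_While)
    fix i r h
    assume inv: "up_inv (Suc i) (r, h)"
    then have "rev [i..<n - 1] = rev [Suc i..<n - 1] @ [i]"
      by (simp add: up_inv_def upt_conv_Cons)
    with inv show "wp (Seq (Sub 4 4 3) (emit 4 7)) (\<lambda>t s. t \<le> 5 \<and> up_inv i s) (r, h)"
      by (intro wp_Seq wp_basic wp_emit[where vs = "snake_rows m n @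
            map (Pair (n - 1)) (rev [0..<?c]) @ map (\<lambda>i. (i, 0)) (rev [Suc i..<n - 1])"])
        (auto simp: up_inv_def elim!: written_cong)
  qed (simp add: up_inv_def)
  have left_up: "left_inv 0 s \<Longrightarrow> up_inv (n - 1) s" for s
    by (auto simp: left_inv_def up_inv_def)
  have rows_left: "wp (Sub 4 4 3) (\<lambda>t s. t = 1 \<and> left_inv ?c s) s" if "rows_inv n m 0 s" for s
  proof -
    obtain r h where "s = (r, h)"
      by (cases s)
    then show ?thesis
      using that assms(3)
      by (auto intro!: wp_basic simp: rows_inv_def left_inv_def elim!: written_cong)
  qed
  have "?c \<le> m"
    by (simp add: snake_def)
  \<comment> \<open>The leading 4 pays for the constants and loads at the start.\<close>
  then have time: "4 + (Suc (n * Suc (8 * m + 5)) + (1 + (Suc (?c * Suc 5) + Suc ((n - 1) * Suc 5))))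
      \<le> 20 * (n + 1) * (m + 1)"
    by (simp add: algebra_simps)
  have up_final: "wp (While 4 (Seq (Sub 4 4 3) (emit 4 7)))
      (\<lambda>t s. t \<le> Suc ((n - 1) * Suc 5) \<and> written (traversal n m) s) s"
    if "left_inv 0 s" for s
    using up[OF left_up[OF that]] by (rule wp_mono) (auto simp: up_inv_def traversal_def)
  have left_final: "wp (Seq (While 7 (Seq (Sub 7 7 3) (emit 4 7))) (While 4 (Seq (Sub 4 4 3) (emit 4 7))))
      (\<lambda>t s. t \<le> Suc (?c * Suc 5) + Suc ((n - 1) * Suc 5) \<and> written (traversal n m) s) s"
    if "left_inv ?c s" for s
    by (rule wp_Seq, rule wp_mono[OF left[OF that]]) (auto intro!: wp_mono[OF up_final])
  have final: "wp (Seq (Sub 4 4 3)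
        (Seq (While 7 (Seq (Sub 7 7 3) (emit 4 7))) (While 4 (Seq (Sub 4 4 3) (emit 4 7)))))
      (\<lambda>t s. t \<le> 1 + (Suc (?c * Suc 5) + Suc ((n - 1) * Suc 5)) \<and> written (traversal n m) s) s"
    if "rows_inv n m 0 s" for s
    by (rule wp_Seq, rule wp_mono[OF rows_left[OF that]]) (auto intro!: wp_mono[OF left_final])
  \<comment> \<open>The current row, its parity and the constant 0 rely on the registers being 0
    initially.\<close>
  have start: "rows_inv n m n (r(0 := 0, 1 := n, 3 := 1, 2 := m), h)"
    using assms(5) by (simp add: rows_inv_def written_def output_word_def encode_vertices_def)
  have "wp (Seq (While 1 rows_step) (Seq (Sub 4 4 3)
        (Seq (While 7 (Seq (Sub 7 7 3) (emit 4 7))) (While 4 (Seq (Sub 4 4 3) (emit 4 7))))))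
      (\<lambda>t s. 4 + t \<le> 20 * (n + 1) * (m + 1) \<and> written (traversal n m) s)
      (r(0 := 0, 1 := n, 3 := 1, 2 := m), h)"
  proof (rule wp_Seq, rule wp_mono[OF rows[OF start]], elim conjE)
    fix t s
    assume t: "t \<le> Suc (n * Suc (8 * m + 5))" and s: "rows_inv n m 0 s"
    show "wp (Seq (Sub 4 4 3)
        (Seq (While 7 (Seq (Sub 7 7 3) (emit 4 7))) (While 4 (Seq (Sub 4 4 3) (emit 4 7)))))
      (\<lambda>u s. 4 + (t + u) \<le> 20 * (n + 1) * (m + 1) \<and> written (traversal n m) s) s"
      using final[OF s] by (rule wp_mono) (use t time in linarith)
  qed
  then show ?thesis
    unfolding traverse_def using assms(1,2)
    by (intro wp_Seq[where c = "Const _ _"] wp_Seq[where c = "Load _ _"] wp_basic) simp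
qed

section \<open>Approximation ratio\<close>

text \<open>All \<open>(n - 1) * m + n * (m - 1)\<close> edges are listed in the input; for positive
  sides this number is at least \<open>n - 1\<close> and \<open>m - 1\<close>.\<close>

lemma length_input_ge:
  assumes "encodes w n m X" "n > 0" "m > 0"
  shows "n \<le> Suc (length w)" "m \<le> Suc (length w)"
proof -
  obtain es xs where es: "enumerates es (edges (grid n m))"
    and w: "w = [n, m, length es] @ encode_edges es @ [length xs] @ encode_edges xs"
    using assms(1) by (auto simp: encodes_def)
  have "length (encode_edges zs) = 4 * length zs" for zs
    by (induction zs) (auto simp: encode_edges_def encode_vertices_def)
  then have len: "length es \<le> length w"
    by (simp add: w)
  have "card (edges (grid n m)) \<le> length es"
    using es card_length[of "map (\<lambda>(u, v). {u, v}) es"] by (simp add: enumerates_def)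
  moreover have "n - 1 \<le> (n - 1) * m" "m - 1 \<le> n * (m - 1)"
    using assms by simp_all
  ultimately show "n \<le> Suc (length w)" "m \<le> Suc (length w)"
    using len unfolding card_edges_grid by linarith+
qed

lemma traverse_correct:
  assumes "star_instance (grid n m) X" "encodes w n m X"
  obtains t s where "exec traverse (input_state w) t s" "t \<le> 20 * (n + 1) * (m + 1)"
    "output_word s = encode_vertices (traversal n m)"
proof -
  have "snd (input_state w) 0 = n" "snd (input_state w) 1 = m"
    using assms(2) by (auto simp: encodes_def input_state_def)
  moreover have "n > 0" "m > 0"
    using star_instance_grid_pos[OF assms(1)] .
  ultimately have "wp traverse (\<lambda>t s. t \<le> 20 * (n + 1) * (m + 1) \<and> written (traversal n m) s)
      (fst (input_state w), snd (input_state w))"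
    by (intro wp_traverse) (auto simp: input_state_def)
  then show ?thesis
    using that by (auto simp: wp_def written_def)
qed

lemma traverse_poly_time: "poly_time_on traverse grid_star_inputs"
  unfolding poly_time_on_def
proof (rule exI, rule ballI)
  \<comment> \<open>The factor \<open>[:2, 1:]\<close> evaluates to \<open>2 + length w\<close>,
    which bounds \<open>n + 1\<close> and \<open>m + 1\<close>.\<close>
  let ?q = "[:20:] * [:2, 1:] * [:2, 1:] :: nat poly"
  fix w
  assume "w \<in> grid_star_inputs"
  then obtain n m X where X: "star_instance (grid n m) X" "encodes w n m X"
    by (auto simp: grid_star_inputs_def)
  then obtain t s where "exec traverse (input_state w) t s" "t \<le> 20 * (n + 1) * (m + 1)"
    by (rule traverse_correct)
  moreover have "20 * (n + 1) * (m + 1) \<le> 20 * (2 + length w) * (2 + length w)"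
    using length_input_ge[OF X(2)] star_instance_grid_pos[OF X(1)] by (intro mult_mono) auto
  ultimately show "\<exists>t s. exec traverse (input_state w) t s \<and> t \<le> poly ?q (length w)"
    by (intro exI[of _ t] exI[of _ s]) (simp add: algebra_simps)
qed

lemma traverse_outputs:
  assumes "star_instance (grid n m) X" "encodes w n m X"
  shows "outputs traverse w (encode_vertices (traversal n m))"
  using traverse_correct[OF assms] unfolding outputs_def by metis

lemma traversal_solution:
  assumes "star_instance (grid n m) X"
  shows "closed_walk (grid n m) (traversal n m)" "covers (traversal n m) X"
  using traversal_walk[OF star_instance_grid_pos[OF assms]] traversal_covers[OF assms] by simp_all

text \<open>The traversal shows that covering walks exist, so the minimum is attained and the bound
  for covering walks applies to it.\<close>

lemma OPT_lower_bound:
  assumes "star_instance (grid n m) X"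
  shows "2 * (n * m) \<le> 3 * OPT (grid n m) X + 8 * (n + m) + 4 + card (edges (grid n m) - X)"
proof -
  have "\<exists>k p. closed_walk (grid n m) p \<and> covers p X \<and> walk_length p = k"
    using traversal_solution[OF assms] by blast
  from LeastI_ex[OF this] obtain p
    where "closed_walk (grid n m) p" "covers p X" "walk_length p = OPT (grid n m) X"
    by (auto simp: OPT_def)
  with covering_walk_length[of n m p X] show ?thesis
    by simp
qed

text \<open>This \<open>\<delta>\<close> is the solution of \<open>(3 / 2 + \<epsilon>) * (2 / 3 - \<delta>) = 1 + \<delta>\<close>.\<close>

lemma traversal_ratio:
  fixes \<epsilon> \<delta> :: real
  assumes X: "star_instance (grid n m) X"
    and \<epsilon>: "\<epsilon> > 0" and \<delta>: "\<delta> = 2 * \<epsilon> / (3 * (5 / 2 + \<epsilon>))"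
    and "24 \<le> \<delta> * n" "24 \<le> \<delta> * m"
    and "card (edges (grid n m) - X) \<le> \<delta> * card (edges (grid n m))"
  shows "walk_length (traversal n m) \<le> (3 / 2 + \<epsilon>) * OPT (grid n m) X"
proof -
  define N where "N = real n * real m"
  have "\<delta> > 0"
    using \<epsilon> \<delta> by simp
  have "n > 0" "m > 0"
    using star_instance_grid_pos[OF X] .
  \<comment> \<open>The constant 24 makes \<open>8 * (n + m) + 4\<close> at most
    \<open>\<delta> * N\<close>. The uncovered edges add \<open>2 * (\<delta> * N)\<close>, so
    dividing by 3 leaves a loss of exactly \<open>\<delta> * N\<close> in the bound on the
    optimum.\<close>
  then have "24 * real m \<le> \<delta> * N" "24 * real n \<le> \<delta> * N" "real m \<ge> 1" "real n \<ge> 1"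
    using assms(4,5) mult_right_mono[of 24 "\<delta> * n" "real m"] mult_right_mono[of 24 "\<delta> * m" "real n"]
    by (simp_all add: N_def mult_ac)
  moreover have "real (card (edges (grid n m))) \<le> 2 * N"
    using card_edges_grid_le[of n m] unfolding N_def by (metis of_nat_le_iff of_nat_mult of_nat_numeral)
  then have "\<delta> * card (edges (grid n m)) \<le> \<delta> * (2 * N)"
    using \<open>\<delta> > 0\<close> by (intro mult_left_mono) simp_all
  then have "card (edges (grid n m) - X) \<le> 2 * (\<delta> * N)"
    using assms(6) by (simp add: mult.left_commute)
  moreover have "2 * N \<le> 3 * real (OPT (grid n m) X) + 8 * (real n + real m) + 4 +
      real (card (edges (grid n m) - X))"
    using OPT_lower_bound[OF X, THEN of_nat_mono[where 'a = real]] unfolding N_def by simp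
  moreover have "real (walk_length (traversal n m)) \<le> N + real n + real m"
    using traversal_length[of n m, THEN of_nat_mono[where 'a = real]] unfolding N_def by simp
  ultimately have "2 / 3 * N - \<delta> * N \<le> real (OPT (grid n m) X)"
    "real (walk_length (traversal n m)) \<le> N + \<delta> * N"
    by auto
  then have opt: "(2 / 3 - \<delta>) * N \<le> real (OPT (grid n m) X)"
    and len: "real (walk_length (traversal n m)) \<le> (1 + \<delta>) * N"
    by (simp_all add: algebra_simps)
  have "(1 + \<delta>) * N = (3 / 2 + \<epsilon>) * ((2 / 3 - \<delta>) * N)"
    using \<epsilon> unfolding \<delta> by (simp add: field_simps)
  also have "\<dots> \<le> (3 / 2 + \<epsilon>) * OPT (grid n m) X"
    using opt \<epsilon> by (intro mult_left_mono) auto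
  finally show ?thesis
    using len by simp
qed

theorem theorem6:
  fixes f :: "nat \<times> nat \<Rightarrow> real"
  assumes nonneg: "\<And>n m. 0 \<le> f (n, m)"
    and small: "f \<in> o[sequentially \<times>\<^sub>F sequentially](\<lambda>(n, m). real (card (edges (grid n m))))"
  shows "\<exists>P. poly_time_on P grid_star_inputs \<and> solves_grid_star P \<and>
    (\<forall>\<epsilon>::real. \<epsilon> > 0 \<longrightarrow>
      (\<exists>n\<^sub>\<epsilon>>0. \<exists>m\<^sub>\<epsilon>>0. \<forall>n\<ge>n\<^sub>\<epsilon>. \<forall>m\<ge>m\<^sub>\<epsilon>. \<forall>X w.
        star_instance (grid n m) X \<and>
        real (card (edges (grid n m) - X)) \<le> f (n, m) \<and>
        encodes w n m X \<longrightarrow>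
        (\<exists>p. outputs P w (encode_vertices p) \<and>
          closed_walk (grid n m) p \<and> covers p X \<and>
          real (walk_length p) \<le> (3 / 2 + \<epsilon>) * real (OPT (grid n m) X))))"
\<comment> \<open>The program depends on neither \<open>f\<close> nor \<open>\<epsilon>\<close>;
  only the thresholds do.\<close>
proof (rule exI[of _ traverse], intro conjI allI impI)
  show "poly_time_on traverse grid_star_inputs"
    by (rule traverse_poly_time)
  show "solves_grid_star traverse"
    unfolding solves_grid_star_def using traverse_outputs traversal_solution by blast
  fix \<epsilon> :: real
  assume \<epsilon>: "\<epsilon> > 0"
  define \<delta> where "\<delta> = 2 * \<epsilon> / (3 * (5 / 2 + \<epsilon>))"
  have "\<delta> > 0"
    using \<epsilon> by (simp add: \<delta>_def)
  \<comment> \<open>The product filter yields one threshold for both sides, and nonnegativity of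
    \<open>f\<close> removes the norm.\<close>
  from landau_o.smallD[OF small this]
  obtain N where N: "f (n, m) \<le> \<delta> * card (edges (grid n m))" if "n \<ge> N" "m \<ge> N" for n m
    using nonneg unfolding eventually_prod_sequentially by fastforce
  \<comment> \<open>\<open>Suc N\<close> keeps the threshold positive; the second term gives the
    size bound required for the ratio.\<close>
  define M where "M = max (Suc N) (nat \<lceil>24 / \<delta>\<rceil>)"
  have large: "24 \<le> \<delta> * n" if "n \<ge> M" for n :: nat
  proof -
    have "24 / \<delta> \<le> n"
      using that unfolding M_def by linarith
    then show ?thesis
      using \<open>\<delta> > 0\<close> by (simp add: field_simps)
  qed
  have "\<exists>p. outputs traverse w (encode_vertices p) \<and> closed_walk (grid n m) p \<and> covers p X \<and>
      real (walk_length p) \<le> (3 / 2 + \<epsilon>) * real (OPT (grid n m) X)"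
    if "n \<ge> M" "m \<ge> M" "star_instance (grid n m) X"
      "real (card (edges (grid n m) - X)) \<le> f (n, m)" "encodes w n m X" for n m X w
  proof -
    have "n \<ge> N" "m \<ge> N"
      using that by (simp_all add: M_def)
    then have "card (edges (grid n m) - X) \<le> \<delta> * card (edges (grid n m))"
      using N that(4) by (meson order_trans)
    then have "walk_length (traversal n m) \<le> (3 / 2 + \<epsilon>) * OPT (grid n m) X"
      using that \<epsilon> \<delta>_def large by (intro traversal_ratio) auto
    then show ?thesis
      using that traverse_outputs traversal_solution by blast
  qed
  moreover have "M > 0"
    by (simp add: M_def)
  ultimately show "\<exists>n\<^sub>\<epsilon>>0. \<exists>m\<^sub>\<epsilon>>0. \<forall>n\<ge>n\<^sub>\<epsilon>. \<forall>m\<ge>m\<^sub>\<epsilon>. \<forall>X w.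
        star_instance (grid n m) X \<and>
        real (card (edges (grid n m) - X)) \<le> f (n, m) \<and>
        encodes w n m X \<longrightarrow>
        (\<exists>p. outputs traverse w (encode_vertices p) \<and>
          closed_walk (grid n m) p \<and> covers p X \<and>
          real (walk_length p) \<le> (3 / 2 + \<epsilon>) * real (OPT (grid n m) X))"
    by blast
qed

end
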